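(* Let $p,q\ge 1$ and $n\ge 2$ be integers, $N=\{1,\dots,n\}$, and let $\mathcal{A}\in\mathbb{R}^{[p,q;n,n]}$ be a real $(p,q)$th order $n\times n$ dimensional rectangular tensor. Let $S$ be a nonempty proper subset of $N$ and $\bar S=N\setminus S$. Then every singular value of $\mathcal{A}$ lies in $\Psi^S(\mathcal{A})$, i.e. $$\sigma(\mathcal{A})\subseteq \Psi^S(\mathcal{A}):=\left(\bigcup_{i\in S,\,j\in\bar S}\left(\hat\Psi^{S}_{i,j}(\mathcal{A})\cup\tilde\Psi^{S}_{i,j}(\mathcal{A})\right)\right)\cup\left(\bigcup_{i\in\bar S,\,j\in S}\left(\hat\Psi^{\bar S}_{i,j}(\mathcal{A})\cup\tilde\Psi^{\bar S}_{i,j}(\mathcal{A})\right)\right),$$ where, for $T\in\{S,\bar S\}$, $$\hat\Psi^{T}_{i,j}(\mathcal{A})=\left\{z\in\mathbb{C}:\left(|z|-r_j^{\overline{\Delta^T}}(\mathcal{A})\right)|z|\le r_j^{\Delta^T}(\mathcal{A})\max\{R_i(\mathcal{A}),C_i(\mathcal{A})\}\right\},$$ $$\tilde\Psi^{T}_{i,j}(\mathcal{A})=\left\{z\in\mathbb{C}:\left(|z|-c_j^{\overline{\Omega^T}}(\mathcal{A})\right)|z|\le c_j^{\Omega^T}(\mathcal{A})\max\{R_i(\mathcal{A}),C_i(\mathcal{A})\}\right\}.$$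
   Context: $\mathbb{R}^{[p,q;n,n]}$ is the set of arrays $\mathcal{A}=(a_{i_1\cdots i_pj_1\cdots j_q})$ of real numbers with all indices in $N=\{1,\dots,n\}$. Put $l=p+q$. Singular values: $\lambda\in\mathbb{C}$ is a singular value of $\mathcal{A}$ if there are $x\in\mathbb{C}^n\setminus\{0\}$ and $y\in\mathbb{C}^n\setminus\{0\}$ with $\mathcal{A}x^{p-1}y^q=\lambda x^{[l-1]}$ and $\mathcal{A}x^py^{q-1}=\lambda y^{[l-1]}$, where $(x^{[l-1]})_i=x_i^{l-1}$, $(y^{[l-1]})_j=y_j^{l-1}$, $$(\mathcal{A}x^{p-1}y^q)_i=\sum_{i_2,\dots,i_p=1}^n\sum_{j_1,\dots,j_q=1}^n a_{ii_2\cdots i_pj_1\cdots j_q}x_{i_2}\cdots x_{i_p}y_{j_1}\cdots y_{j_q},$$ $$(\mathcal{A}x^{p}y^{q-1})_j=\sum_{i_1,\dots,i_p=1}^n\sum_{j_2,\dots,j_q=1}^n a_{i_1\cdots i_pjj_2\cdots j_q}x_{i_1}\cdots x_{i_p}y_{j_2}\cdots y_{j_q}.$$ $\sigma(\mathcal{A})$ denotes the set of all singular values of $\mathcal{A}$. Row/column sums: $R_i(\mathcal{A})=\sum_{i_2,\dots,i_p,j_1,\dots,j_q\in N}|a_{ii_2\cdots i_pj_1\cdots j_q}|$ and $C_j(\mathcal{A})=\sum_{i_1,\dots,i_p,j_2,\dots,j_q\in N}|a_{i_1\cdots i_pjj_2\cdots j_q}|$. For $T\subseteq N$ let $\Delta^T=\{(i_2,\dots,i_p,j_1,\dots,j_q):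 \text{all entries in }T\}$, $\Omega^T=\{(i_1,\dots,i_p,j_2,\dots,j_q):\text{all entries in }T\}$, $\overline{\Delta^T}=\Delta^N\setminus\Delta^T$, $\overline{\Omega^T}=\Omega^N\setminus\Omega^T$. For $i,j\in N$, with $\Delta'\in\{\Delta^T,\overline{\Delta^T}\}$ and $\Omega'\in\{\Omega^T,\overline{\Omega^T}\}$, $$r_i^{\Delta'}(\mathcal{A})=\sum_{(i_2,\dots,i_p,j_1,\dots,j_q)\in\Delta'}|a_{ii_2\cdots i_pj_1\cdots j_q}|,\qquad c_j^{\Omega'}(\mathcal{A})=\sum_{(i_1,\dots,i_p,j_2,\dots,j_q)\in\Omega'}|a_{i_1\cdots i_pjj_2\cdots j_q}|.$$ *)

theory Defs
  imports "HOL-Analysis.Analysis"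
begin

text \<open>
  The index set \<open>N\<close> with \<open>n\<close> elements is the universe of a finite type \<open>'n\<close>, so \<open>n = CARD('n)\<close>.
  The entry of \<open>A\<close> at \<open>i\<^sub>1, \<dots>, i\<^sub>p, j\<^sub>1, \<dots>, j\<^sub>q\<close> is \<open>A [i\<^sub>1, \<dots>, i\<^sub>p] [j\<^sub>1, \<dots>, j\<^sub>q]\<close>. Values of \<open>A\<close>
  at lists of other lengths are never used when \<open>p, q \<ge> 1\<close>.
\<close>

type_synonym 'n tensor = "'n list \<Rightarrow> 'n list \<Rightarrow> real"

text \<open>Pairs \<open>([i\<^sub>2, \<dots>, i\<^sub>p], [j\<^sub>1, \<dots>, j\<^sub>q])\<close> and \<open>([i\<^sub>1, \<dots>, i\<^sub>p], [j\<^sub>2, \<dots>, j\<^sub>q])\<close> with all entries in \<open>T\<close>.\<close>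

definition Delta :: "nat \<Rightarrow> nat \<Rightarrow> 'n set \<Rightarrow> ('n list \<times> 'n list) set" where
  "Delta p q T = {(u, v). length u = p - 1 \<and> length v = q \<and> set u \<subseteq> T \<and> set v \<subseteq> T}"

definition Omega :: "nat \<Rightarrow> nat \<Rightarrow> 'n set \<Rightarrow> ('n list \<times> 'n list) set" where
  "Omega p q T = {(u, v). length u = p \<and> length v = q - 1 \<and> set u \<subseteq> T \<and> set v \<subseteq> T}"

definition Delta_bar :: "nat \<Rightarrow> nat \<Rightarrow> 'n set \<Rightarrow> ('n list \<times> 'n list) set" where
  "Delta_bar p q T = Delta p q UNIV - Delta p q T"

definition Omega_bar :: "nat \<Rightarrow> nat \<Rightarrow> 'n set \<Rightarrow> ('n list \<times> 'n list) set" where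
  "Omega_bar p q T = Omega p q UNIV - Omega p q T"

lemma finite_Delta [simp]: "finite (Delta p q (T :: 'n::finite set))"
  by (rule finite_subset[of _ "{u. set u \<subseteq> T \<and> length u = p - 1} \<times> {v. set v \<subseteq> T \<and> length v = q}"])
    (auto simp: Delta_def intro!: finite_cartesian_product finite_lists_length_eq)

lemma finite_Omega [simp]: "finite (Omega p q (T :: 'n::finite set))"
  by (rule finite_subset[of _ "{u. set u \<subseteq> T \<and> length u = p} \<times> {v. set v \<subseteq> T \<and> length v = q - 1}"])
    (auto simp: Omega_def intro!: finite_cartesian_product finite_lists_length_eq)

text \<open>The vectors \<open>A x\<^sup>p\<^sup>-\<^sup>1 y\<^sup>q\<close> and \<open>A x\<^sup>p y\<^sup>q\<^sup>-\<^sup>1\<close>.\<close>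

definition apply_left ::
  "nat \<Rightarrow> nat \<Rightarrow> 'n tensor \<Rightarrow> complex ^ 'n \<Rightarrow> complex ^ 'n \<Rightarrow> complex ^ ('n::finite)" where
  "apply_left p q A x y = (\<chi> i. \<Sum>(u, v)\<in>Delta p q UNIV.
     complex_of_real (A (i # u) v) * (\<Prod>k\<leftarrow>u. x $ k) * (\<Prod>k\<leftarrow>v. y $ k))"

definition apply_right ::
  "nat \<Rightarrow> nat \<Rightarrow> 'n tensor \<Rightarrow> complex ^ 'n \<Rightarrow> complex ^ 'n \<Rightarrow> complex ^ ('n::finite)" where
  "apply_right p q A x y = (\<chi> j. \<Sum>(u, v)\<in>Omega p q UNIV.
     complex_of_real (A u (j # v)) * (\<Prod>k\<leftarrow>u. x $ k) * (\<Prod>k\<leftarrow>v. y $ k))"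

definition comp_power :: "complex ^ 'n \<Rightarrow> nat \<Rightarrow> complex ^ ('n::finite)" where
  "comp_power x m = (\<chi> i. (x $ i) ^ m)"

definition singular_values :: "nat \<Rightarrow> nat \<Rightarrow> ('n::finite) tensor \<Rightarrow> complex set" where
  "singular_values p q A = {z. \<exists>x y. x \<noteq> 0 \<and> y \<noteq> 0 \<and>
     apply_left p q A x y = z *s comp_power x (p + q - 1) \<and>
     apply_right p q A x y = z *s comp_power y (p + q - 1)}"

definition row_part :: "'n tensor \<Rightarrow> ('n list \<times> 'n list) set \<Rightarrow> 'n \<Rightarrow> real" where
  "row_part A D i = (\<Sum>(u, v)\<in>D. \<bar>A (i # u) v\<bar>)"

definition col_part :: "'n tensor \<Rightarrow> ('n list \<times> 'n list) set \<Rightarrow> 'n \<Rightarrow> real" where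
  "col_part A D j = (\<Sum>(u, v)\<in>D. \<bar>A u (j # v)\<bar>)"

definition row_sum :: "nat \<Rightarrow> nat \<Rightarrow> 'n tensor \<Rightarrow> 'n \<Rightarrow> real" where
  "row_sum p q A i = row_part A (Delta p q UNIV) i"

definition col_sum :: "nat \<Rightarrow> nat \<Rightarrow> 'n tensor \<Rightarrow> 'n \<Rightarrow> real" where
  "col_sum p q A j = col_part A (Omega p q UNIV) j"

definition Psi_hat :: "nat \<Rightarrow> nat \<Rightarrow> 'n tensor \<Rightarrow> 'n set \<Rightarrow> 'n \<Rightarrow> 'n \<Rightarrow> complex set" where
  "Psi_hat p q A T i j = {z. (cmod z - row_part A (Delta_bar p q T) j) * cmod z
     \<le> row_part A (Delta p q T) j * max (row_sum p q A i) (col_sum p q A i)}"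

definition Psi_tilde :: "nat \<Rightarrow> nat \<Rightarrow> 'n tensor \<Rightarrow> 'n set \<Rightarrow> 'n \<Rightarrow> 'n \<Rightarrow> complex set" where
  "Psi_tilde p q A T i j = {z. (cmod z - col_part A (Omega_bar p q T) j) * cmod z
     \<le> col_part A (Omega p q T) j * max (row_sum p q A i) (col_sum p q A i)}"

definition Psi :: "nat \<Rightarrow> nat \<Rightarrow> 'n tensor \<Rightarrow> 'n set \<Rightarrow> complex set" where
  "Psi p q A S =
     (\<Union>i\<in>S. \<Union>j\<in>- S. Psi_hat p q A S i j \<union> Psi_tilde p q A S i j) \<union>
     (\<Union>i\<in>- S. \<Union>j\<in>S. Psi_hat p q A (- S) i j \<union> Psi_tilde p q A (- S) i j)"

end

theory Submission
  imports Defs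
begin

text \<open>
  Let \<open>z\<close> be a singular value with vectors \<open>x\<close>, \<open>y\<close>, put \<open>m = p + q - 1\<close> and
  \<open>w k = max \<bar>x\<^sub>k\<bar> \<bar>y\<^sub>k\<bar>\<close>. Choose an index maximising \<open>w\<close> in \<open>S\<close> and one maximising
  it in \<open>- S\<close>. One of the two, called \<open>j\<close>, maximises \<open>w\<close> globally; the other one, \<open>i\<close>, does so
  only on its own side \<open>T\<close> of the partition. The defining equation at \<open>j\<close>, taken from the left
  system if \<open>w j = \<bar>x\<^sub>j\<bar>\<close> and from the right system otherwise, is a sum of terms of degree
  \<open>m\<close>. The terms with all indices in \<open>T\<close> are controlled by \<open>w i\<close> and the others by \<open>w j\<close>,
  so that in the left case
  \<open>\<bar>z\<bar> (w j)\<^sup>m \<le> r\<^sub>j (w i)\<^sup>m + r'\<^sub>j (w j)\<^sup>m\<close>,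
  where \<open>r\<^sub>j\<close> and \<open>r'\<^sub>j\<close> are the parts of the row sum at \<open>j\<close> over \<open>Delta p q T\<close> and over its
  complement. The equation at \<open>i\<close>, estimated crudely, gives
  \<open>\<bar>z\<bar> (w i)\<^sup>m \<le> max R\<^sub>i C\<^sub>i (w j)\<^sup>m\<close>. Multiplying the first inequality by \<open>\<bar>z\<bar>\<close> and
  inserting the second one yields
  \<open>(\<bar>z\<bar> - r'\<^sub>j) \<bar>z\<bar> (w j)\<^sup>m \<le> r\<^sub>j max R\<^sub>i C\<^sub>i (w j)\<^sup>m\<close>,
  and \<open>w j > 0\<close> can be cancelled because \<open>x \<noteq> 0\<close>. Combining the inequalities in this order
  avoids dividing by \<open>w i\<close>, which may vanish.
\<close>

definition entry_size :: "complex ^ 'n \<Rightarrow> complex ^ 'n \<Rightarrow> ('n::finite) \<Rightarrow> real" where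
  "entry_size x y k = max (cmod (x $ k)) (cmod (y $ k))"

lemma norm_prod_list_le_power:
  fixes x :: "complex ^ ('n::finite)"
  assumes "\<And>k. k \<in> set u \<Longrightarrow> cmod (x $ k) \<le> a"
  shows "cmod (\<Prod>k\<leftarrow>u. x $ k) \<le> a ^ length u"
  using assms
proof (induction u)
  case (Cons k u)
  have "cmod (x $ k) \<le> a" "cmod (\<Prod>k\<leftarrow>u. x $ k) \<le> a ^ length u"
    using Cons by auto
  then have "cmod (x $ k) * cmod (\<Prod>k\<leftarrow>u. x $ k) \<le> a * a ^ length u"
    by (rule mult_mono') auto
  then show ?case
    by (simp add: norm_mult)
qed simp

text \<open>
  The coefficients \<open>B\<close> are arbitrary so that both systems, in which the distinguished index sits
  in different places of the tensor, are instances; \<open>D\<close> is arbitrary so that the sum can be split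
  into blocks with different bounds \<open>a\<close>.
\<close>

lemma norm_multilinear_sum_le:
  fixes x y :: "complex ^ ('n::finite)" and B :: "'n tensor"
  assumes "finite D"
    and size: "\<And>u v. (u, v) \<in> D \<Longrightarrow> length u + length v = m"
    and bound: "\<And>u v k. (u, v) \<in> D \<Longrightarrow> k \<in> set u \<union> set v \<Longrightarrow> entry_size x y k \<le> a"
  shows "cmod (\<Sum>(u, v)\<in>D. complex_of_real (B u v) * (\<Prod>k\<leftarrow>u. x $ k) * (\<Prod>k\<leftarrow>v. y $ k))
    \<le> (\<Sum>(u, v)\<in>D. \<bar>B u v\<bar>) * a ^ m"
proof -
  have "cmod (complex_of_real (B u v) * (\<Prod>k\<leftarrow>u. x $ k) * (\<Prod>k\<leftarrow>v. y $ k)) \<le> \<bar>B u v\<bar> * a ^ m"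
    if "(u, v) \<in> D" for u v
  proof -
    have x: "cmod (\<Prod>k\<leftarrow>u. x $ k) \<le> a ^ length u"
      by (rule norm_prod_list_le_power) (use bound[OF that] in \<open>auto simp: entry_size_def\<close>)
    have y: "cmod (\<Prod>k\<leftarrow>v. y $ k) \<le> a ^ length v"
      by (rule norm_prod_list_le_power) (use bound[OF that] in \<open>auto simp: entry_size_def\<close>)
    have "cmod (\<Prod>k\<leftarrow>u. x $ k) * cmod (\<Prod>k\<leftarrow>v. y $ k) \<le> a ^ length u * a ^ length v"
      using x y by (rule mult_mono') auto
    then show ?thesis
      using size[OF that]
      by (simp add: norm_mult mult.assoc mult_left_mono flip: power_add)
  qed
  then have "cmod (\<Sum>(u, v)\<in>D. complex_of_real (B u v) * (\<Prod>k\<leftarrow>u. x $ k) * (\<Prod>k\<leftarrow>v. y $ k))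
    \<le> (\<Sum>(u, v)\<in>D. \<bar>B u v\<bar> * a ^ m)"
    by (intro sum_norm_le) auto
  then show ?thesis
    by (simp add: sum_distrib_right case_prod_unfold)
qed

lemma norm_multilinear_sum_split_le:
  fixes x y :: "complex ^ ('n::finite)" and B :: "'n tensor"
  assumes "finite E" and "D \<subseteq> E"
    and size: "\<And>u v. (u, v) \<in> E \<Longrightarrow> length u + length v = m"
    and inner: "\<And>u v k. (u, v) \<in> D \<Longrightarrow> k \<in> set u \<union> set v \<Longrightarrow> entry_size x y k \<le> a"
    and outer: "\<And>k. entry_size x y k \<le> b"
  shows "cmod (\<Sum>(u, v)\<in>E. complex_of_real (B u v) * (\<Prod>k\<leftarrow>u. x $ k) * (\<Prod>k\<leftarrow>v. y $ k))
    \<le> (\<Sum>(u, v)\<in>D. \<bar>B u v\<bar>) * a ^ m + (\<Sum>(u, v)\<in>E - D. \<bar>B u v\<bar>) * b ^ m"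
proof -
  let ?f = "\<lambda>(u, v). complex_of_real (B u v) * (\<Prod>k\<leftarrow>u. x $ k) * (\<Prod>k\<leftarrow>v. y $ k)"
  have "sum ?f E = sum ?f D + sum ?f (E - D)"
    by (subst sum.subset_diff[OF assms(2,1)]) (rule add.commute)
  also have "cmod \<dots> \<le> cmod (sum ?f D) + cmod (sum ?f (E - D))"
    by (rule norm_triangle_ineq)
  also have "cmod (sum ?f D) \<le> (\<Sum>(u, v)\<in>D. \<bar>B u v\<bar>) * a ^ m"
    by (rule norm_multilinear_sum_le[OF finite_subset[OF assms(2,1)]])
      (use assms(2) size inner in blast)+
  also have "cmod (sum ?f (E - D)) \<le> (\<Sum>(u, v)\<in>E - D. \<bar>B u v\<bar>) * b ^ m"
    by (rule norm_multilinear_sum_le[OF finite_Diff[OF assms(1)]])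
      (use size outer in blast)+
  finally show ?thesis
    by simp
qed

text \<open>
  Here \<open>\<rho>\<close> is the modulus of the singular value, \<open>\<alpha>\<close> and \<open>\<beta>\<close> are the \<open>m\<close>-th powers of the local
  and of the global maximum of \<open>entry_size\<close>. Multiplying the global bound by \<open>\<rho>\<close> makes the local
  one applicable, so only \<open>\<beta>\<close> has to be cancelled.
\<close>

lemma combine_local_and_global_bound:
  fixes \<rho> r r' M \<alpha> \<beta> :: real
  assumes "\<beta> > 0" "\<rho> \<ge> 0" "r \<ge> 0"
    and global: "\<rho> * \<beta> \<le> r * \<alpha> + r' * \<beta>"
    and local_max: "\<rho> * \<alpha> \<le> M * \<beta>"
  shows "(\<rho> - r') * \<rho> \<le> r * M"
proof -
  have "(\<rho> - r') * \<rho> * \<beta> = \<rho> * (\<rho> * \<beta> - r' * \<beta>)"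
    by (simp add: algebra_simps)
  also have "\<dots> \<le> \<rho> * (r * \<alpha>)"
    using global \<open>\<rho> \<ge> 0\<close> by (intro mult_left_mono) auto
  also have "\<dots> = r * (\<rho> * \<alpha>)"
    by simp
  also have "\<dots> \<le> r * (M * \<beta>)"
    using local_max \<open>r \<ge> 0\<close> by (rule mult_left_mono)
  finally show ?thesis
    using \<open>\<beta> > 0\<close> by (simp flip: mult.assoc)
qed

text \<open>
  The argument for one choice of sides: \<open>i\<close> is the local maximiser on \<open>T\<close> and \<open>j\<close> the global one.
\<close>

lemma singular_value_mem_Psi_of_maximisers:
  fixes p q :: nat and A :: "('n::finite) tensor"
  assumes pq: "p \<ge> 1" "q \<ge> 1" and "x \<noteq> 0"
    and left: "apply_left p q A x y = z *s comp_power x (p + q - 1)"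
    and right: "apply_right p q A x y = z *s comp_power y (p + q - 1)"
    and i: "\<And>k. k \<in> T \<Longrightarrow> entry_size x y k \<le> entry_size x y i"
    and j: "\<And>k. entry_size x y k \<le> entry_size x y j"
  shows "z \<in> Psi_hat p q A T i j \<union> Psi_tilde p q A T i j"
proof -
  let ?m = "p + q - 1"
  let ?w = "entry_size x y"
  have left_at: "cmod z * cmod (x $ k) ^ ?m
      \<le> row_part A (Delta p q U) k * a ^ ?m + row_part A (Delta_bar p q U) k * ?w j ^ ?m"
    if "\<And>h. h \<in> U \<Longrightarrow> ?w h \<le> a" for k U a
  proof -
    have "cmod z * cmod (x $ k) ^ ?m = cmod (apply_left p q A x y $ k)"
      by (simp add: left comp_power_def norm_mult norm_power)
    also have "\<dots> \<le> row_part A (Delta p q U) k * a ^ ?m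
        + row_part A (Delta_bar p q U) k * ?w j ^ ?m"
      unfolding apply_left_def row_part_def Delta_bar_def vec_lambda_beta
      by (rule norm_multilinear_sum_split_le[OF finite_Delta])
        (use that j pq in \<open>auto simp: Delta_def\<close>)
    finally show ?thesis .
  qed
  have right_at: "cmod z * cmod (y $ k) ^ ?m
      \<le> col_part A (Omega p q U) k * a ^ ?m + col_part A (Omega_bar p q U) k * ?w j ^ ?m"
    if "\<And>h. h \<in> U \<Longrightarrow> ?w h \<le> a" for k U a
  proof -
    have "cmod z * cmod (y $ k) ^ ?m = cmod (apply_right p q A x y $ k)"
      by (simp add: right comp_power_def norm_mult norm_power)
    also have "\<dots> \<le> col_part A (Omega p q U) k * a ^ ?m
        + col_part A (Omega_bar p q U) k * ?w j ^ ?m"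
      unfolding apply_right_def col_part_def Omega_bar_def vec_lambda_beta
      by (rule norm_multilinear_sum_split_le[OF finite_Omega])
        (use that j pq in \<open>auto simp: Omega_def\<close>)
    finally show ?thesis .
  qed
  obtain k where "x $ k \<noteq> 0"
    using \<open>x \<noteq> 0\<close> by (auto simp: vec_eq_iff)
  then have "?w k > 0"
    by (simp add: entry_size_def less_max_iff_disj)
  then have pos: "?w j ^ ?m > 0"
    using j[of k] by (intro zero_less_power) linarith
  let ?M = "max (row_sum p q A i) (col_sum p q A i)"
  have local_max: "cmod z * ?w i ^ ?m \<le> ?M * ?w j ^ ?m"
  proof (cases "cmod (y $ i) \<le> cmod (x $ i)")
    case True
    \<comment> \<open>The block over \<open>UNIV\<close> is the full row sum; the complementary block is empty.\<close>
    then have "cmod z * ?w i ^ ?m \<le> row_sum p q A i * ?w j ^ ?m"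
      using left_at[of UNIV "?w j" i] j
      by (simp add: entry_size_def row_sum_def Delta_bar_def row_part_def)
    also have "\<dots> \<le> ?M * ?w j ^ ?m"
      using pos by (intro mult_right_mono) auto
    finally show ?thesis .
  next
    case False
    then have "cmod z * ?w i ^ ?m \<le> col_sum p q A i * ?w j ^ ?m"
      using right_at[of UNIV "?w j" i] j
      by (simp add: entry_size_def col_sum_def Omega_bar_def col_part_def)
    also have "\<dots> \<le> ?M * ?w j ^ ?m"
      using pos by (intro mult_right_mono) auto
    finally show ?thesis .
  qed
  show ?thesis
  proof (cases "cmod (y $ j) \<le> cmod (x $ j)")
    case True
    then have "?w j = cmod (x $ j)"
      by (simp add: entry_size_def)
    then have "(cmod z - row_part A (Delta_bar p q T) j) * cmod z
        \<le> row_part A (Delta p q T) j * ?M"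
      using left_at[OF i, of T j] local_max
      by (intro combine_local_and_global_bound[OF pos])
        (auto simp: row_part_def intro!: sum_nonneg)
    then show ?thesis
      by (simp add: Psi_hat_def)
  next
    case False
    then have "?w j = cmod (y $ j)"
      by (simp add: entry_size_def)
    then have "(cmod z - col_part A (Omega_bar p q T) j) * cmod z
        \<le> col_part A (Omega p q T) j * ?M"
      using right_at[OF i, of T j] local_max
      by (intro combine_local_and_global_bound[OF pos])
        (auto simp: col_part_def intro!: sum_nonneg)
    then show ?thesis
      by (simp add: Psi_tilde_def)
  qed
qed

lemma exists_maximiser_on:
  fixes f :: "'n::finite \<Rightarrow> real"
  assumes "T \<noteq> {}"
  obtains t where "t \<in> T" "\<And>k. k \<in> T \<Longrightarrow> f k \<le> f t"
proof -
  have "Max (f ` T) \<in> f ` T"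
    using assms by (intro Max_in) auto
  then obtain t where t: "t \<in> T" "f t = Max (f ` T)"
    by auto
  then have "f k \<le> f t" if "k \<in> T" for k
    using that by simp
  then show ?thesis
    using t(1) that by blast
qed

theorem theorem3:
  fixes p q :: nat and A :: "('n::finite) tensor" and S :: "'n set"
  assumes "p \<ge> 1" and "q \<ge> 1" and "CARD('n) \<ge> 2"
    and "S \<noteq> {}" and "S \<noteq> UNIV"
  shows "singular_values p q A \<subseteq> Psi p q A S"
proof
  fix z assume "z \<in> singular_values p q A"
  then obtain x y where "x \<noteq> 0"
    and left: "apply_left p q A x y = z *s comp_power x (p + q - 1)"
    and right: "apply_right p q A x y = z *s comp_power y (p + q - 1)"
    by (auto simp: singular_values_def)
  note mem_Psi = singular_value_mem_Psi_of_maximisers[OF assms(1,2) \<open>x \<noteq> 0\<close> left right]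
  let ?w = "entry_size x y"
  obtain s where s: "s \<in> S" "\<And>k. k \<in> S \<Longrightarrow> ?w k \<le> ?w s"
    using exists_maximiser_on[OF \<open>S \<noteq> {}\<close>, of ?w] by blast
  have "- S \<noteq> {}"
    using \<open>S \<noteq> UNIV\<close> by auto
  then obtain t where t: "t \<in> - S" "\<And>k. k \<in> - S \<Longrightarrow> ?w k \<le> ?w t"
    using exists_maximiser_on[of "- S" ?w] by blast
  show "z \<in> Psi p q A S"
  proof (cases "?w s \<le> ?w t")
    case True
    then have "?w k \<le> ?w t" for k
      using s(2)[of k] t(2)[of k] by (cases "k \<in> S") auto
    then have "z \<in> Psi_hat p q A S s t \<union> Psi_tilde p q A S s t"
      by (intro mem_Psi s(2))
    then show ?thesis
      using s(1) t(1) unfolding Psi_def by blast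
  next
    case False
    then have "?w k \<le> ?w s" for k
      using s(2)[of k] t(2)[of k] by (cases "k \<in> S") auto
    then have "z \<in> Psi_hat p q A (- S) t s \<union> Psi_tilde p q A (- S) t s"
      by (intro mem_Psi t(2))
    then show ?thesis
      using s(1) t(1) unfolding Psi_def by blast
  qed
qed

end
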